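(* Let $f \in \mathcal{S}^*$ have the form $f(z)= z +\sum_{n=2}^{\infty} a_n z^n$. Then the third order Hankel determinant $H_3(1) = a_3(a_2 a_4-a_3^2)-a_4(a_4-a_2 a_3)+a_5(a_3-a_2^2)$ of $f$ satisfies $$|H_3(1)| \leq \frac{4}{9},$$ and this bound is sharp, i.e. there exists a function in $\mathcal{S}^*$ for which $|H_3(1)| = 4/9$.
   Context: $\mathbb{D}$ is the open unit disk in $\mathbb{C}$. $\mathcal{A}$ is the class of analytic functions on $\mathbb{D}$ of the form $f(z) = z+\sum_{n=2}^{\infty} a_n z^n$, and $\mathcal{S}\subset\mathcal{A}$ is the subclass of univalent (injective) functions. The class $\mathcal{S}^*$ of starlike functions consists of all $f\in\mathcal{S}$ such that $\operatorname{Re}\dfrac{z f'(z)}{f(z)} > 0$ for all $z\in\mathbb{D}$ (the quotient is understood to take the value $1$ at $z=0$). *)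

theory Defs
  imports "HOL-Complex_Analysis.Complex_Analysis"
begin

abbreviation unit_disk :: "complex set" where
  "unit_disk \<equiv> ball 0 1"

(* f(z) = z + sum_{n >= 2} a_n z^n on the unit disk; a 0 and a 1 play no role. *)
definition normalized_expansion :: "(complex \<Rightarrow> complex) \<Rightarrow> (nat \<Rightarrow> complex) \<Rightarrow> bool" where
  "normalized_expansion f a \<longleftrightarrow>
     (\<forall>z\<in>unit_disk. (\<lambda>n. a (n + 2) * z ^ (n + 2)) sums (f z - z))"

(* HOL functions are total: membership in the classes below only depends on the
   values of f on the disk, the values elsewhere are arbitrary. *)
definition class_A :: "(complex \<Rightarrow> complex) set" where
  "class_A = {f. f analytic_on unit_disk \<and> (\<exists>a. normalized_expansion f a)}"

definition class_S :: "(complex \<Rightarrow> complex) set" where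
  "class_S = {f \<in> class_A. inj_on f unit_disk}"

(* At 0 the quotient has a removable singularity with value 1, whereas 0 / 0 = 0 in HOL. *)
definition starlike_quotient :: "(complex \<Rightarrow> complex) \<Rightarrow> complex \<Rightarrow> complex" where
  "starlike_quotient f z = (if z = 0 then 1 else z * deriv f z / f z)"

(* Starlike functions; unrelated to the predicate starlike on sets. *)
definition class_S_star :: "(complex \<Rightarrow> complex) set" where
  "class_S_star = {f \<in> class_S. \<forall>z\<in>unit_disk. Re (starlike_quotient f z) > 0}"

definition hankel_3_1 :: "(nat \<Rightarrow> complex) \<Rightarrow> complex" where
  "hankel_3_1 a = a 3 * (a 2 * a 4 - (a 3)\<^sup>2) - a 4 * (a 4 - a 2 * a 3) + a 5 * (a 3 - (a 2)\<^sup>2)"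

end

(* For a starlike f, Schwarz's lemma writes z f'/f = (1 + z w)/(1 - z w) with w in the unit ball of
   H^infinity. Three steps of the Schur algorithm express the first four Taylor coefficients of w by
   parameters t, x, y, v in the closed unit disk, and 18 H_3(1) becomes a polynomial in these
   parameters and their conjugates, arranged so that the triangle inequality loses little. What
   remains is an inequality for real polynomials in |t|, |x|, |y| on the unit cube, with equality
   at t = x = 0, |y| = 1; correspondingly w = z^2 yields the extremal function z (1 - z^3)^(-2/3). *)
theory Submission
  imports Defs
begin

unbundle no vec_syntax

section \<open>Schwarz's lemma and one step of the Schur algorithm\<close>

text \<open>The bound is not strict: quotients produced by Schwarz's lemma can be unimodular
  constants, as for the Koebe function, where \<open>w\<close> is the constant 1.\<close>

definition schur_class :: "(complex \<Rightarrow> complex) set" where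
  "schur_class = {f. f holomorphic_on unit_disk \<and> (\<forall>z\<in>unit_disk. norm (f z) \<le> 1)}"

lemma schur_class_holomorphic: "f \<in> schur_class \<Longrightarrow> f holomorphic_on unit_disk"
  and schur_class_norm: "f \<in> schur_class \<Longrightarrow> norm z < 1 \<Longrightarrow> norm (f z) \<le> 1"
  by (auto simp: schur_class_def)

text \<open>Away from 0 the bound on \<open>g\<close> is \<open>norm (f z) \<le> norm z\<close>
  divided by \<open>norm z\<close>; at 0 it is the derivative part of Schwarz's lemma.\<close>

lemma schwarz_quotient:
  assumes "f holomorphic_on unit_disk" "f 0 = 0" "\<And>z. norm z < 1 \<Longrightarrow> norm (f z) < 1"
  obtains g where "g \<in> schur_class" "\<And>z. norm z < 1 \<Longrightarrow> f z = z * g z"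
proof -
  obtain g where g: "g holomorphic_on unit_disk" "\<And>z. norm z < 1 \<Longrightarrow> f z = z * g z" "deriv f 0 = g 0"
    using Schwarz3[OF assms(1,2)] by blast
  have "norm (g z) \<le> 1" if z: "norm z < 1" for z
  proof (cases "z = 0")
    case True
    then show ?thesis using Schwarz_Lemma(2)[OF assms z] g(3) by simp
  next
    case False
    have "norm z * norm (g z) \<le> norm z * 1"
      using Schwarz_Lemma(1)[OF assms z] g(2)[OF z] by (simp add: norm_mult)
    then show ?thesis using False by simp
  qed
  then have "g \<in> schur_class" using g(1) by (simp add: schur_class_def)
  then show ?thesis using g(2) that by blast
qed

lemma disk_automorphism_norm:
  assumes "norm a < 1" "norm b < 1"
  shows "norm (b - a) < norm (1 - cnj a * b)"
proof -
  have "of_real ((norm (1 - cnj a * b))\<^sup>2 - (norm (b - a))\<^sup>2)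
      = complex_of_real ((1 - (norm a)\<^sup>2) * (1 - (norm b)\<^sup>2))"
    by (simp only: of_real_diff of_real_mult of_real_1 complex_norm_square) (simp add: algebra_simps)
  then have "(norm (1 - cnj a * b))\<^sup>2 - (norm (b - a))\<^sup>2 = (1 - (norm a)\<^sup>2) * (1 - (norm b)\<^sup>2)"
    by (simp only: of_real_eq_iff)
  also have "\<dots> > 0" using assms by (simp add: power_less_one_iff abs_square_less_1)
  finally have "(norm (b - a))\<^sup>2 < (norm (1 - cnj a * b))\<^sup>2" by simp
  then show ?thesis by (rule power_less_imp_less_base) simp
qed

text \<open>By the maximum modulus principle, modulus 1 at an interior point forces the function to
  be constant.\<close>

lemma schur_class_cases:
  assumes "f \<in> schur_class"
  obtains c where "\<And>z. norm z < 1 \<Longrightarrow> f z = c" | "\<And>z. norm z < 1 \<Longrightarrow> norm (f z) < 1"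
proof (cases "\<exists>w. norm w < 1 \<and> norm (f w) = 1")
  case True
  then obtain w where w: "norm w < 1" "norm (f w) = 1" by blast
  have "f constant_on unit_disk"
    by (rule maximum_modulus_principle[where U = unit_disk and \<xi> = w])
      (use assms w in \<open>auto simp: schur_class_def\<close>)
  then show ?thesis using that(1) by (auto simp: constant_on_def)
next
  case False
  then have "norm (f z) < 1" if "norm z < 1" for z
    using schur_class_norm[OF assms that] that by (metis order_le_less)
  then show ?thesis using that(2) by blast
qed

text \<open>The Moebius transform sending \<open>f 0\<close> to 0 is applied to \<open>f\<close>,
  and Schwarz's lemma divides the result by \<open>z\<close>. The inverse transform is stated
  without denominators, so that it also makes sense in the degenerate case and carries over to power
  series.\<close>

lemma schur_step:
  assumes f: "f \<in> schur_class"
  obtains g where "g \<in> schur_class"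
    "\<And>z. norm z < 1 \<Longrightarrow> f z * (1 + cnj (f 0) * (z * g z)) = f 0 + z * g z"
  using f
proof (cases rule: schur_class_cases)
  case (1 c)
  \<comment> \<open>This also covers norm (f 0) = 1, where the Moebius transform below degenerates.\<close>
  show ?thesis
    by (rule that[of "\<lambda>_. 0"]) (auto simp: 1 schur_class_def)
next
  case 2
  define h where "h z = (f z - f 0) / (1 - cnj (f 0) * f z)" for z
  have less: "norm (f z - f 0) < norm (1 - cnj (f 0) * f z)" if "norm z < 1" for z
    using 2 that by (intro disk_automorphism_norm) auto
  then have nz: "1 - cnj (f 0) * f z \<noteq> 0" if "norm z < 1" for z
    using that by (metis norm_not_less_zero norm_zero)
  have "h holomorphic_on unit_disk"
    unfolding h_def using schur_class_holomorphic[OF f] nz by (intro holomorphic_intros) auto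
  moreover have "norm (h z) < 1" if "norm z < 1" for z
    using less[OF that] nz[OF that] by (simp add: h_def norm_divide)
  ultimately obtain g where g: "g \<in> schur_class" "\<And>z. norm z < 1 \<Longrightarrow> h z = z * g z"
    using schwarz_quotient[of h] by (auto simp: h_def)
  have "f z * (1 + cnj (f 0) * h z) = f 0 + h z" if "norm z < 1" for z
    unfolding h_def using nz[OF that] by (simp add: field_simps)
  with g show ?thesis using that by simp
qed

section \<open>The Schur algorithm on Taylor coefficients\<close>

lemma eventually_unit_disk: "eventually (\<lambda>z::complex. norm z < 1) (nhds 0)"
  using eventually_nhds_in_open[of unit_disk 0] by simp

lemma fps_eqI_unit_disk:
  fixes F G :: "complex fps"
  assumes F: "f has_fps_expansion F" and G: "g has_fps_expansion G"
    and eq: "\<And>z. norm z < 1 \<Longrightarrow> f z = g z"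
  shows "F = G"
proof -
  have "eventually (\<lambda>z. f z = g z) (nhds 0)"
    using eventually_unit_disk by eventually_elim (rule eq)
  from has_fps_expansion_cong[OF this refl] F have "g has_fps_expansion F" by simp
  then show ?thesis using G by (rule fps_expansion_unique_complex)
qed

lemma schur_class_fps_expansion: "f \<in> schur_class \<Longrightarrow> f has_fps_expansion fps_expansion f 0"
  by (rule has_fps_expansion_fps_expansion[of unit_disk]) (auto simp: schur_class_def)

lemma schur_step_fps:
  assumes f: "f \<in> schur_class" and F: "f has_fps_expansion F"
  obtains g G where "g \<in> schur_class" "g has_fps_expansion G"
    "F * (1 + fps_const (cnj (F $ 0)) * (fps_X * G)) = fps_const (F $ 0) + fps_X * G"
proof -
  obtain g where g: "g \<in> schur_class"
    "\<And>z. norm z < 1 \<Longrightarrow> f z * (1 + cnj (f 0) * (z * g z)) = f 0 + z * g z"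
    using schur_step[OF f] by blast
  define G where "G = fps_expansion g 0"
  have G: "g has_fps_expansion G"
    unfolding G_def by (rule schur_class_fps_expansion[OF g(1)])
  have F0: "F $ 0 = f 0" using has_fps_expansion_imp_0_eq_fps_nth_0[OF F] by simp
  have "(\<lambda>z. f z * (1 + cnj (f 0) * (z * g z))) has_fps_expansion
      F * (1 + fps_const (cnj (F $ 0)) * (fps_X * G))"
    unfolding F0 by (intro fps_expansion_intros F G)
  moreover have "(\<lambda>z. f 0 + z * g z) has_fps_expansion fps_const (F $ 0) + fps_X * G"
    unfolding F0 by (intro fps_expansion_intros F G)
  ultimately have "F * (1 + fps_const (cnj (F $ 0)) * (fps_X * G)) = fps_const (F $ 0) + fps_X * G"
    by (rule fps_eqI_unit_disk) (rule g(2))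
  with g(1) G that show ?thesis by blast
qed

text \<open>Coefficients of index \<open>Suc n\<close> are compared. The factor \<open>fps_X\<close>
  in front of \<open>F * G\<close> shifts the index, so only \<open>F $ k\<close> with k \<le> n
  occur on the right and the formula is a recursion.\<close>

lemma schur_step_coeffs:
  fixes F G :: "complex fps"
  assumes "F * (1 + fps_const c * (fps_X * G)) = fps_const (F $ 0) + fps_X * G"
  shows "F $ Suc n = G $ n - c * (\<Sum>k\<le>n. F $ k * G $ (n - k))"
proof -
  have "F + fps_const c * (fps_X * (F * G)) = fps_const (F $ 0) + fps_X * G"
    using assms by (simp add: algebra_simps)
  then have "(F + fps_const c * (fps_X * (F * G))) $ Suc n = (fps_const (F $ 0) + fps_X * G) $ Suc n"
    by simp
  then have "F $ Suc n + c * (F * G) $ n = G $ n"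
    by (simp only: fps_add_nth fps_mult_left_const_nth fps_X_mult_nth) simp
  then show ?thesis
    by (simp add: fps_mult_nth atLeast0AtMost algebra_simps)
qed

text \<open>Three Schur steps lead from \<open>F\<close> to \<open>G\<close>, \<open>H\<close> and
  \<open>K\<close>; the parameters \<open>t\<close>, \<open>x\<close>, \<open>y\<close>,
  \<open>v\<close> are the constant terms of these four series. Substituting the recursions into
  each other gives the formulas.\<close>

lemma schur_parameters:
  assumes f: "f \<in> schur_class" and F: "f has_fps_expansion F"
  obtains t x y v where "norm t \<le> 1" "norm x \<le> 1" "norm y \<le> 1" "norm v \<le> 1"
    "F $ 0 = t" "F $ 1 = (1 - t * cnj t) * x"
    "F $ 2 = (1 - t * cnj t) * ((1 - x * cnj x) * y - cnj t * x\<^sup>2)"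
    "F $ 3 = (1 - t * cnj t) * ((1 - x * cnj x) * (1 - y * cnj y) * v - (1 - x * cnj x) * cnj x * y\<^sup>2
       - 2 * cnj t * (1 - x * cnj x) * x * y + (cnj t)\<^sup>2 * x ^ 3)"
proof -
  obtain g G where g: "g \<in> schur_class" "g has_fps_expansion G"
    and FG: "F * (1 + fps_const (cnj (F $ 0)) * (fps_X * G)) = fps_const (F $ 0) + fps_X * G"
    using schur_step_fps[OF f F] by blast
  obtain h H where h: "h \<in> schur_class" "h has_fps_expansion H"
    and GH: "G * (1 + fps_const (cnj (G $ 0)) * (fps_X * H)) = fps_const (G $ 0) + fps_X * H"
    using schur_step_fps[OF g] by blast
  obtain k K where k: "k \<in> schur_class" "k has_fps_expansion K"
    and HK: "H * (1 + fps_const (cnj (H $ 0)) * (fps_X * K)) = fps_const (H $ 0) + fps_X * K"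
    using schur_step_fps[OF h] by blast
  have norms: "norm (F $ 0) \<le> 1" "norm (G $ 0) \<le> 1" "norm (H $ 0) \<le> 1" "norm (K $ 0) \<le> 1"
    using F f g h k by (auto simp: has_fps_expansion_imp_0_eq_fps_nth_0[symmetric] schur_class_def)
  note step = schur_step_coeffs[OF FG] schur_step_coeffs[OF GH] schur_step_coeffs[OF HK]
  have H1: "H $ 1 = (1 - H $ 0 * cnj (H $ 0)) * K $ 0"
    using step(3)[of 0] by (simp add: algebra_simps)
  have G1: "G $ 1 = (1 - G $ 0 * cnj (G $ 0)) * H $ 0"
    using step(2)[of 0] by (simp add: algebra_simps)
  have G2: "G $ 2 = H $ 1 - cnj (G $ 0) * (G $ 0 * H $ 1 + G $ 1 * H $ 0)"
    using step(2)[of 1] by (simp add: numeral_2_eq_2)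
  have F1: "F $ 1 = (1 - F $ 0 * cnj (F $ 0)) * G $ 0"
    using step(1)[of 0] by (simp add: algebra_simps)
  have F2: "F $ 2 = G $ 1 - cnj (F $ 0) * (F $ 0 * G $ 1 + F $ 1 * G $ 0)"
    using step(1)[of 1] by (simp add: numeral_2_eq_2)
  have F3: "F $ 3 = G $ 2 - cnj (F $ 0) * (F $ 0 * G $ 2 + F $ 1 * G $ 1 + F $ 2 * G $ 0)"
    using step(1)[of 2] by (simp add: numeral_2_eq_2 numeral_3_eq_3)
  show ?thesis
  proof (rule that[OF norms])
    show "F $ 2 = (1 - F $ 0 * cnj (F $ 0)) * ((1 - G $ 0 * cnj (G $ 0)) * H $ 0 - cnj (F $ 0) * (G $ 0)\<^sup>2)"
      unfolding F2 F1 G1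
      by (simp add: algebra_simps power2_eq_square)
    show "F $ 3 = (1 - F $ 0 * cnj (F $ 0)) * ((1 - G $ 0 * cnj (G $ 0)) * (1 - H $ 0 * cnj (H $ 0)) * K $ 0
       - (1 - G $ 0 * cnj (G $ 0)) * cnj (G $ 0) * (H $ 0)\<^sup>2
       - 2 * cnj (F $ 0) * (1 - G $ 0 * cnj (G $ 0)) * G $ 0 * H $ 0 + (cnj (F $ 0))\<^sup>2 * (G $ 0) ^ 3)"
      unfolding F3 F2 F1 G2 G1 H1
      by (simp add: algebra_simps power2_eq_square power3_eq_cube)
  qed (use F1 in auto)
qed

section \<open>Coefficients of a starlike function and the resulting Hankel polynomial\<close>

lemma normalized_expansion_fps:
  assumes "normalized_expansion f a"
  defines "A \<equiv> Abs_fps (\<lambda>n. if n = 0 then 0 else if n = 1 then 1 else a n)"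
  shows "f has_fps_expansion A"
proof (rule has_fps_expansionI)
  show "eventually (\<lambda>z. (\<lambda>n. A $ n * z ^ n) sums f z) (nhds 0)"
    using eventually_unit_disk
  proof eventually_elim
    case (elim z)
    have "(\<lambda>n. A $ (n + 2) * z ^ (n + 2)) sums (f z - (\<Sum>n<2. A $ n * z ^ n))"
      using assms(1) elim by (simp add: normalized_expansion_def A_def lessThan_nat_numeral numeral_2_eq_2)
    then show ?case using sums_iff_shift[of "\<lambda>n. A $ n * z ^ n" 2] by simp
  qed
qed

text \<open>The equation is rearranged to z f' - f = z w (z f' + f). In coefficients, the left side
  multiplies that of index n + 1 by n, and the bracket multiplies that of index k by k + 1.\<close>

lemma starlike_coeffs:
  assumes a: "normalized_expansion f a" and W: "w has_fps_expansion W"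
    and eq: "\<And>z. norm z < 1 \<Longrightarrow> z * deriv f z * (1 - z * w z) = f z * (1 + z * w z)"
  shows "a 2 = 2 * W $ 0" "2 * a 3 = 3 * W $ 0 * a 2 + 2 * W $ 1"
    "3 * a 4 = 4 * W $ 0 * a 3 + 3 * W $ 1 * a 2 + 2 * W $ 2"
    "4 * a 5 = 5 * W $ 0 * a 4 + 4 * W $ 1 * a 3 + 3 * W $ 2 * a 2 + 2 * W $ 3"
proof -
  define A where "A = Abs_fps (\<lambda>n. if n = 0 then 0 else if n = 1 then 1 else a n)"
  have A: "f has_fps_expansion A" unfolding A_def by (rule normalized_expansion_fps[OF a])
  have "(\<lambda>z. z * deriv f z * (1 - z * w z)) has_fps_expansion fps_X * fps_deriv A * (1 - fps_X * W)"
    by (intro fps_expansion_intros A W)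
  moreover have "(\<lambda>z. f z * (1 + z * w z)) has_fps_expansion A * (1 + fps_X * W)"
    by (intro fps_expansion_intros A W)
  ultimately have "fps_X * fps_deriv A * (1 - fps_X * W) = A * (1 + fps_X * W)"
    by (rule fps_eqI_unit_disk) (rule eq)
  then have "fps_X * fps_deriv A - A = fps_X * ((fps_X * fps_deriv A + A) * W)"
    by algebra
  then have "(fps_X * fps_deriv A - A) $ Suc n = ((fps_X * fps_deriv A + A) * W) $ n" for n
    by simp
  moreover have "(fps_X * fps_deriv A - A) $ Suc n = of_nat n * A $ Suc n"
    and X: "(fps_X * fps_deriv A + A) $ n = of_nat (n + 1) * A $ n" for n
    by (auto simp: algebra_simps fps_X_mult_nth)
  ultimately have *: "of_nat n * A $ Suc n = (\<Sum>k\<le>n. of_nat (k + 1) * A $ k * W $ (n - k))" for n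
    by (simp only: fps_mult_nth X atLeast0AtMost)
  show "a 2 = 2 * W $ 0"
    using *[of 1] by (simp add: A_def numeral_2_eq_2)
  show "2 * a 3 = 3 * W $ 0 * a 2 + 2 * W $ 1"
    using *[of 2] by (simp add: A_def eval_nat_numeral algebra_simps)
  show "3 * a 4 = 4 * W $ 0 * a 3 + 3 * W $ 1 * a 2 + 2 * W $ 2"
    using *[of 3] by (simp add: A_def eval_nat_numeral algebra_simps)
  show "4 * a 5 = 5 * W $ 0 * a 4 + 4 * W $ 1 * a 3 + 3 * W $ 2 * a 2 + 2 * W $ 3"
    using *[of 4] by (simp add: A_def eval_nat_numeral algebra_simps)
qed

text \<open>The variables \<open>t'\<close>, \<open>x'\<close>, \<open>y'\<close> stand for the conjugates of \<open>t\<close>, \<open>x\<close>, \<open>y\<close>; the identity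
  holds with all of them independent.\<close>

lemma hankel_identity:
  fixes t t' x x' y y' v :: complex
  defines "s \<equiv> 1 - t * t'" and "q \<equiv> 1 - x * x'"
  defines "w1 \<equiv> s * x"
  defines "w2 \<equiv> s * (q * y - t' * x\<^sup>2)"
  defines "w3 \<equiv> s * (q * (1 - y * y') * v - q * x' * y\<^sup>2 - 2 * t' * q * x * y + t'\<^sup>2 * x ^ 3)"
  assumes a: "a 2 = 2 * t" "2 * a 3 = 3 * t * a 2 + 2 * w1"
    "3 * a 4 = 4 * t * a 3 + 3 * w1 * a 2 + 2 * w2"
    "4 * a 5 = 5 * t * a 4 + 4 * w1 * a 3 + 3 * w2 * a 2 + 2 * w3"
  shows "18 * hankel_3_1 a = s * (3 * t ^ 4 * x - t\<^sup>2 * (11 - 5 * (t * t')) * x\<^sup>2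
     - t * t' * (10 - t * t') * x ^ 3 + s * t'\<^sup>2 * x ^ 4
     + 2 * q * y * (3 * t ^ 3 + t * (5 + 4 * (t * t')) * x - t' * s * x\<^sup>2)
     + q * y\<^sup>2 * (9 * t\<^sup>2 * x' - s * (8 + x * x'))
     + 9 * q * (1 - y * y') * v * (s * x - t\<^sup>2))"
proof -
  \<comment> \<open>Here \<open>w1\<close>, \<open>w2\<close>, \<open>w3\<close> stay folded; the
    Schur parameters are substituted only in the final identity.\<close>
  have e3: "a 3 = 3 * t\<^sup>2 + w1" and e4: "3 * a 4 = 12 * t ^ 3 + 10 * t * w1 + 2 * w2"
    using a(1-3) by algebra+
  then have e5: "12 * a 5 = 60 * t ^ 4 + 86 * t\<^sup>2 * w1 + 12 * w1\<^sup>2 + 28 * t * w2 + 6 * w3"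
    using a by algebra
  show ?thesis
    unfolding hankel_3_1_def
    using a(1) e3 e4 e5 unfolding w1_def w2_def w3_def s_def q_def by algebra
qed

section \<open>The real inequality for the moduli\<close>

text \<open>The variables are eliminated one after the other: \<open>i1\<close> and
  \<open>i2\<close> remove \<open>Y\<close> and the odd powers of \<open>t\<close>,
  \<open>i3\<close> and \<open>i4\<close> remove \<open>X\<close>, and \<open>i5\<close> is an
  inequality in \<open>T\<close> alone. Each estimate is exact at T = X = 0, Y = 1, apart from
  \<open>i2\<close>, whose two sides also agree there.\<close>

lemma hankel_polynomial_bound:
  fixes t X Y :: real
  assumes t: "0 \<le> t" "t \<le> 1" and X: "0 \<le> X" "X \<le> 1" and Y: "0 \<le> Y" "Y \<le> 1"
  defines "T \<equiv> t\<^sup>2"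
  shows "(1 - T) * (T * (3 * T * X + (11 - 5 * T) * X\<^sup>2 + (10 - T) * X ^ 3 + (1 - T) * X ^ 4)
     + 2 * (1 - X\<^sup>2) * Y * t * (3 * T + (5 + 4 * T) * X + (1 - T) * X\<^sup>2)
     + (1 - X\<^sup>2) * Y\<^sup>2 * (9 * T * X + (1 - T) * (8 + X\<^sup>2))
     + 9 * (1 - X\<^sup>2) * (1 - Y\<^sup>2) * ((1 - T) * X + T)) \<le> 8"
proof -
  have T: "0 \<le> T" "T \<le> 1" using t by (simp_all add: T_def power_le_one)
  have X2: "0 \<le> X\<^sup>2" "X\<^sup>2 \<le> 1" using X by (simp_all add: power_le_one)
  define M where "M = 9 * T + (1 - T) * (8 + X\<^sup>2)"
  have Y2: "0 \<le> Y\<^sup>2" "Y\<^sup>2 \<le> 1" using Y by (simp_all add: power_le_one)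
  \<comment> \<open>A convex combination with weight \<open>Y\<^sup>2\<close>: it suffices that \<open>M\<close> dominates both endpoints.\<close>
  have i1: "Y\<^sup>2 * (9 * T * X + (1 - T) * (8 + X\<^sup>2)) + 9 * (1 - Y\<^sup>2) * ((1 - T) * X + T) \<le> M"
  proof -
    have "T * X \<le> T" using T X by (simp add: mult_left_le)
    then have "9 * T * X + (1 - T) * (8 + X\<^sup>2) \<le> M" by (simp add: M_def)
    moreover have "9 * ((1 - T) * X + T) \<le> M"
    proof -
      \<comment> \<open>This product is exactly \<open>M\<close> minus the second endpoint.\<close>
      have "0 \<le> (1 - T) * ((1 - X) * (8 - X))" using T X by simp
      then show ?thesis by (simp add: M_def algebra_simps power2_eq_square)
    qed
    ultimately have "Y\<^sup>2 * (9 * T * X + (1 - T) * (8 + X\<^sup>2)) + (1 - Y\<^sup>2) * (9 * ((1 - T) * X + T))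
        \<le> Y\<^sup>2 * M + (1 - Y\<^sup>2) * M"
      using Y2 by (intro add_mono mult_left_mono) auto
    then show ?thesis by (simp add: algebra_simps)
  qed
  \<comment> \<open>Eliminate odd powers of \<open>t\<close>. The term \<open>t * X\<close> needs the sharper second estimate, which
    vanishes at the maximum \<open>T = X = 0\<close>.\<close>
  have tle: "t \<le> T + 1 / 4" unfolding T_def using zero_le_power2[of "t - 1/2"]
    by (simp add: power2_eq_square algebra_simps)
  have tX: "2 * t * X \<le> T + X\<^sup>2" unfolding T_def using sum_squares_bound[of t X] by simp
  have i2: "2 * Y * t * (3 * T + (5 + 4 * T) * X + (1 - T) * X\<^sup>2)
      \<le> 6 * T * (T + 1 / 4) + (5 + 4 * T) * (T + X\<^sup>2) + 2 * X\<^sup>2 * (T + 1 / 4)" (is "_ \<le> ?B")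
  proof -
    have "Y * (t * (3 * T + (5 + 4 * T) * X + (1 - T) * X\<^sup>2)) \<le> t * (3 * T + (5 + 4 * T) * X + (1 - T) * X\<^sup>2)"
      using Y t T X by (intro mult_left_le_one_le mult_nonneg_nonneg add_nonneg_nonneg) auto
    moreover have "t * T \<le> (T + 1/4) * T" using tle T by (intro mult_right_mono)
    moreover have "(5 + 4 * T) * (2 * t * X) \<le> (5 + 4 * T) * (T + X\<^sup>2)"
      using tX T by (intro mult_left_mono) auto
    moreover have "t * X\<^sup>2 * (1 - T) \<le> t * X\<^sup>2" using t T by (intro mult_right_le_one_le) auto
    moreover have "t * X\<^sup>2 \<le> (T + 1/4) * X\<^sup>2" using tle by (intro mult_right_mono) auto
    ultimately show ?thesis by (simp add: algebra_simps)
  qed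
  have i3: "(10 - T) * X ^ 3 + (1 - T) * X ^ 4 \<le> (11 - 2 * T) * X ^ 3"
  proof -
    have "X ^ 4 \<le> X ^ 3" using X by (intro power_decreasing) auto
    then have "(1 - T) * X ^ 4 \<le> (1 - T) * X ^ 3" using T by (intro mult_left_mono) auto
    then show ?thesis by (simp add: algebra_simps)
  qed
  \<comment> \<open>At X = 0 the left side equals 8 + 15/2 T + 10 T^2. The additional T^2 and 16/3
    T^4 on the right are the constant terms of the squares completed below.\<close>
  have i4: "T * (3 * T * X + (11 - 5 * T) * X\<^sup>2 + (11 - 2 * T) * X ^ 3) + (1 - X\<^sup>2) * (?B + M)
     \<le> 8 + 15 / 2 * T + 11 * T\<^sup>2 + 16 / 3 * T ^ 4"
  proof -
    \<comment> \<open>The squares absorb, in this order, the terms \<open>3 * T\<^sup>2 * X\<close>, \<open>11 * T * X ^ 3\<close> and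
      \<open>8 * T\<^sup>2 * X\<^sup>2\<close>, the last two into \<open>- 13/2 * X ^ 4\<close>.\<close>
    have "0 \<le> T\<^sup>2 * (1 - 3 / 2 * X)\<^sup>2" by simp
    moreover have "0 \<le> 7 / 2 * X\<^sup>2 * (X - 11 / 7 * T)\<^sup>2" by simp
    moreover have "0 \<le> 3 * (X\<^sup>2 - 4 / 3 * T\<^sup>2)\<^sup>2" by simp
    \<comment> \<open>The bracket is what the squares leave of the coefficient of X^2. As a
      quadratic in \<open>T\<close> it has its vertex at 119/339 and a small positive
      minimum.\<close>
    moreover have "0 \<le> X\<^sup>2 * (3 / 2 - 17 / 2 * T + 339 / 28 * T\<^sup>2)"
    proof -
      have "0 \<le> 339 / 28 * (T - 119 / 339)\<^sup>2" by simp
      then show ?thesis by (intro mult_nonneg_nonneg) (auto simp: power2_eq_square algebra_simps)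
    qed
    moreover have "0 \<le> T * X ^ 4" "0 \<le> T\<^sup>2 * X ^ 3" using T X by simp_all
    ultimately show ?thesis
      unfolding M_def by (simp add: field_simps power2_eq_square power3_eq_cube power4_eq_xxxx)
  qed
  \<comment> \<open>The factor \<open>1 - T\<close> makes the linear coefficient 15/2 - 8 = -1/2.
    The gap T/2 - 7/2 T^2 + 11 T^3 - 16/3 T^4 + 16/3 T^5 is a nonnegative combination of the three
    terms below.\<close>
  have i5: "(1 - T) * (8 + 15 / 2 * T + 11 * T\<^sup>2 + 16 / 3 * T ^ 4) \<le> 8"
  proof -
    have "0 \<le> T * (1 - 7 / 2 * T)\<^sup>2 / 2" using T by simp
    moreover have "0 \<le> T ^ 3 * (T - 1 / 2)\<^sup>2" using T by simp
    moreover have "0 \<le> T ^ 3" using T by simp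
    ultimately show ?thesis
      by (simp add: field_simps power2_eq_square power3_eq_cube power4_eq_xxxx)
  qed
  have "(1 - T) * (T * (3 * T * X + (11 - 5 * T) * X\<^sup>2 + (10 - T) * X ^ 3 + (1 - T) * X ^ 4)
     + 2 * (1 - X\<^sup>2) * Y * t * (3 * T + (5 + 4 * T) * X + (1 - T) * X\<^sup>2)
     + (1 - X\<^sup>2) * Y\<^sup>2 * (9 * T * X + (1 - T) * (8 + X\<^sup>2))
     + 9 * (1 - X\<^sup>2) * (1 - Y\<^sup>2) * ((1 - T) * X + T))
    = (1 - T) * (T * (3 * T * X + (11 - 5 * T) * X\<^sup>2 + ((10 - T) * X ^ 3 + (1 - T) * X ^ 4))
     + (1 - X\<^sup>2) * (2 * Y * t * (3 * T + (5 + 4 * T) * X + (1 - T) * X\<^sup>2)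
     + (Y\<^sup>2 * (9 * T * X + (1 - T) * (8 + X\<^sup>2)) + 9 * (1 - Y\<^sup>2) * ((1 - T) * X + T))))"
    by algebra
  also have "\<dots> \<le> (1 - T) * (T * (3 * T * X + (11 - 5 * T) * X\<^sup>2 + (11 - 2 * T) * X ^ 3) + (1 - X\<^sup>2) * (?B + M))"
    using T X2 i1 i2 i3 by (intro mult_left_mono add_mono order_refl) auto
  also have "\<dots> \<le> (1 - T) * (8 + 15 / 2 * T + 11 * T\<^sup>2 + 16 / 3 * T ^ 4)"
    using T i4 by (intro mult_left_mono) auto
  also note i5
  finally show ?thesis .
qed

section \<open>The triangle inequality and the bound in terms of the Schur function\<close>

lemma hankel_bound_schur_parameters:
  fixes t x y v :: complex
  assumes norms: "norm t \<le> 1" "norm x \<le> 1" "norm y \<le> 1" "norm v \<le> 1"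
  defines "s \<equiv> 1 - t * cnj t" and "q \<equiv> 1 - x * cnj x"
  shows "norm (s * (3 * t ^ 4 * x - t\<^sup>2 * (11 - 5 * (t * cnj t)) * x\<^sup>2
     - t * cnj t * (10 - t * cnj t) * x ^ 3 + s * (cnj t)\<^sup>2 * x ^ 4
     + 2 * q * y * (3 * t ^ 3 + t * (5 + 4 * (t * cnj t)) * x - cnj t * s * x\<^sup>2)
     + q * y\<^sup>2 * (9 * t\<^sup>2 * cnj x - s * (8 + x * cnj x))
     + 9 * q * (1 - y * cnj y) * v * (s * x - t\<^sup>2))) \<le> 8"
    (is "norm (s * (?a1 - ?a2 - ?a3 + ?a4 + ?b + ?c + ?d)) \<le> 8")
proof -
  define T where "T = (norm t)\<^sup>2"
  define X where "X = norm x"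
  define Y where "Y = norm y"
  have T: "0 \<le> T" "T \<le> 1" and X2: "0 \<le> X\<^sup>2" "X\<^sup>2 \<le> 1" and Y2: "0 \<le> Y\<^sup>2" "Y\<^sup>2 \<le> 1"
    using norms by (simp_all add: T_def X_def Y_def power_le_one)
  have tt: "t * cnj t = of_real T" and xx: "x * cnj x = of_real (X\<^sup>2)" and yy: "y * cnj y = of_real (Y\<^sup>2)"
    unfolding T_def X_def Y_def complex_norm_square by (rule refl)+
  have s: "s = of_real (1 - T)" and q: "q = of_real (1 - X\<^sup>2)" and r: "1 - y * cnj y = of_real (1 - Y\<^sup>2)"
    unfolding s_def q_def tt xx yy by simp_all
  have t4: "norm t ^ 4 = T\<^sup>2" and t3: "norm t ^ 3 = norm t * T"
    by (simp_all add: T_def power4_eq_xxxx power3_eq_cube power2_eq_square)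
  \<comment> \<open>These factors are nonnegative reals, so their norms are computed exactly; the
    triangle inequality is spent only on the remaining sums.\<close>
  have n: "norm s = 1 - T" "norm q = 1 - X\<^sup>2" "norm (1 - y * cnj y) = 1 - Y\<^sup>2"
    "norm (11 - 5 * (t * cnj t)) = 11 - 5 * T" "norm (10 - t * cnj t) = 10 - T"
    "norm (5 + 4 * (t * cnj t)) = 5 + 4 * T" "norm (8 + x * cnj x) = 8 + X\<^sup>2" "norm (t * cnj t) = T"
  proof -
    have "11 - 5 * (t * cnj t) = of_real (11 - 5 * T)" "10 - t * cnj t = of_real (10 - T)"
      "5 + 4 * (t * cnj t) = of_real (5 + 4 * T)" "8 + x * cnj x = of_real (8 + X\<^sup>2)"
      unfolding tt xx by simp_all
    then show "norm s = 1 - T" "norm q = 1 - X\<^sup>2" "norm (1 - y * cnj y) = 1 - Y\<^sup>2"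
      "norm (11 - 5 * (t * cnj t)) = 11 - 5 * T" "norm (10 - t * cnj t) = 10 - T"
      "norm (5 + 4 * (t * cnj t)) = 5 + 4 * T" "norm (8 + x * cnj x) = 8 + X\<^sup>2" "norm (t * cnj t) = T"
      using T X2 Y2 by (simp_all only: s q r tt norm_of_real)
  qed
  have a1: "norm ?a1 = 3 * T\<^sup>2 * X"
    unfolding norm_mult norm_power t4 X_def by simp
  have a2: "norm ?a2 = T * (11 - 5 * T) * X\<^sup>2"
    unfolding norm_mult[of _ "x\<^sup>2"] norm_mult[of "t\<^sup>2"] norm_power n by (simp add: T_def X_def)
  have a3: "norm ?a3 = T * (10 - T) * X ^ 3"
    unfolding norm_mult[of _ "x ^ 3"] norm_mult[of "t * cnj t"] norm_power n by (simp add: X_def)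
  have a4: "norm ?a4 = (1 - T) * T * X ^ 4"
    unfolding norm_mult norm_power n by (simp add: T_def X_def)
  have b: "norm ?b \<le> 2 * (1 - X\<^sup>2) * Y * (3 * (norm t * T) + norm t * (5 + 4 * T) * X + norm t * (1 - T) * X\<^sup>2)"
  proof -
    have "norm (3 * t ^ 3 + t * (5 + 4 * (t * cnj t)) * x - cnj t * s * x\<^sup>2)
        \<le> norm (3 * t ^ 3) + norm (t * (5 + 4 * (t * cnj t)) * x) + norm (cnj t * s * x\<^sup>2)"
      by (rule order_trans[OF norm_triangle_ineq4 add_right_mono[OF norm_triangle_ineq]])
    also have "\<dots> = 3 * (norm t * T) + norm t * (5 + 4 * T) * X + norm t * (1 - T) * X\<^sup>2"
      unfolding norm_mult[of _ x] norm_mult[of t "5 + _"] norm_mult[of _ "x\<^sup>2"] norm_mult[of "cnj t"]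
        norm_mult[of 3] norm_power n t3 by (simp add: X_def)
    finally show ?thesis
      unfolding norm_mult[of "2 * q * y"] norm_mult[of "2 * q"] norm_mult[of 2] n
      using X2 by (intro mult_mono) (simp_all add: Y_def)
  qed
  have c: "norm ?c \<le> (1 - X\<^sup>2) * Y\<^sup>2 * (9 * T * X + (1 - T) * (8 + X\<^sup>2))"
  proof -
    have "norm (9 * t\<^sup>2 * cnj x - s * (8 + x * cnj x)) \<le> norm (9 * t\<^sup>2 * cnj x) + norm (s * (8 + x * cnj x))"
      by (rule norm_triangle_ineq4)
    also have "\<dots> = 9 * T * X + (1 - T) * (8 + X\<^sup>2)"
      unfolding norm_mult[of s] n norm_mult[of _ "cnj x"] by (simp add: norm_mult norm_power T_def X_def)
    finally show ?thesis
      unfolding norm_mult[of "q * y\<^sup>2"] norm_mult[of q] norm_power n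
      using X2 by (intro mult_mono) (simp_all add: Y_def)
  qed
  have d: "norm ?d \<le> 9 * (1 - X\<^sup>2) * (1 - Y\<^sup>2) * ((1 - T) * X + T)"
  proof -
    have "norm (s * x - t\<^sup>2) \<le> norm (s * x) + norm (t\<^sup>2)"
      by (rule norm_triangle_ineq4)
    also have "\<dots> = (1 - T) * X + T"
      unfolding norm_mult n by (simp add: norm_power T_def X_def)
    finally have *: "norm (s * x - t\<^sup>2) \<le> (1 - T) * X + T" .
    \<comment> \<open>The parameter \<open>v\<close> enters only through this term and is removed by
      its bound 1.\<close>
    have "9 * (1 - X\<^sup>2) * (1 - Y\<^sup>2) * norm v \<le> 9 * (1 - X\<^sup>2) * (1 - Y\<^sup>2)"
      using X2 Y2 norms by (intro mult_right_le_one_le) auto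
    with * show ?thesis
      unfolding norm_mult[of "_ * v"] norm_mult[of _ v] norm_mult[of "9 * q"] norm_mult[of 9] n
      using X2 Y2 by (intro mult_mono[of "_ * norm v"]) simp_all
  qed
  have "norm (?a1 - ?a2 - ?a3 + ?a4 + ?b + ?c + ?d)
      \<le> norm ?a1 + norm ?a2 + norm ?a3 + norm ?a4 + norm ?b + norm ?c + norm ?d"
    by (intro order_trans[OF norm_triangle_ineq add_right_mono]
        order_trans[OF norm_triangle_ineq4 add_right_mono] order_refl)
  also have "\<dots> \<le> 3 * T\<^sup>2 * X + T * (11 - 5 * T) * X\<^sup>2 + T * (10 - T) * X ^ 3 + (1 - T) * T * X ^ 4
      + 2 * (1 - X\<^sup>2) * Y * (3 * (norm t * T) + norm t * (5 + 4 * T) * X + norm t * (1 - T) * X\<^sup>2)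
      + (1 - X\<^sup>2) * Y\<^sup>2 * (9 * T * X + (1 - T) * (8 + X\<^sup>2))
      + 9 * (1 - X\<^sup>2) * (1 - Y\<^sup>2) * ((1 - T) * X + T)"
    unfolding a1 a2 a3 a4 by (intro add_mono b c d order_refl)
  also have "\<dots> = T * (3 * T * X + (11 - 5 * T) * X\<^sup>2 + (10 - T) * X ^ 3 + (1 - T) * X ^ 4)
     + 2 * (1 - X\<^sup>2) * Y * norm t * (3 * T + (5 + 4 * T) * X + (1 - T) * X\<^sup>2)
     + (1 - X\<^sup>2) * Y\<^sup>2 * (9 * T * X + (1 - T) * (8 + X\<^sup>2))
     + 9 * (1 - X\<^sup>2) * (1 - Y\<^sup>2) * ((1 - T) * X + T)"
    by algebra
  finally have "norm (s * (?a1 - ?a2 - ?a3 + ?a4 + ?b + ?c + ?d)) \<le> (1 - T) * \<dots>"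
    unfolding norm_mult[of s] n using T by (intro mult_left_mono) auto
  also have "\<dots> \<le> 8"
    using hankel_polynomial_bound[of "norm t" X Y] norms by (simp add: T_def X_def Y_def)
  finally show ?thesis .
qed

lemma hankel_bound_schur_class:
  assumes a: "normalized_expansion f a" and w: "w \<in> schur_class"
    and eq: "\<And>z. norm z < 1 \<Longrightarrow> z * deriv f z * (1 - z * w z) = f z * (1 + z * w z)"
  shows "norm (hankel_3_1 a) \<le> 4 / 9"
proof -
  define W where "W = fps_expansion w 0"
  have W: "w has_fps_expansion W"
    unfolding W_def by (rule schur_class_fps_expansion[OF w])
  obtain t x y v where par: "norm t \<le> 1" "norm x \<le> 1" "norm y \<le> 1" "norm v \<le> 1"
    "W $ 0 = t" "W $ 1 = (1 - t * cnj t) * x"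
    "W $ 2 = (1 - t * cnj t) * ((1 - x * cnj x) * y - cnj t * x\<^sup>2)"
    "W $ 3 = (1 - t * cnj t) * ((1 - x * cnj x) * (1 - y * cnj y) * v - (1 - x * cnj x) * cnj x * y\<^sup>2
       - 2 * cnj t * (1 - x * cnj x) * x * y + (cnj t)\<^sup>2 * x ^ 3)"
    using schur_parameters[OF w W] by metis
  note id = hankel_identity[OF starlike_coeffs[OF a W eq, unfolded par(5-8)]]
  have "norm (18 * hankel_3_1 a) \<le> 8"
    by (simp only: id) (rule hankel_bound_schur_parameters[OF par(1-4)])
  then show ?thesis by (simp add: norm_mult)
qed

section \<open>From starlike functions to the Schur class\<close>

text \<open>The Cayley transform u = (p - 1)/(p + 1) of p = z f'/f maps into the unit disk and
  vanishes at 0, so Schwarz's lemma gives u = z w.\<close>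

lemma starlike_schur_function:
  assumes "f \<in> class_S_star"
  obtains w where "w \<in> schur_class"
    "\<And>z. norm z < 1 \<Longrightarrow> z * deriv f z * (1 - z * w z) = f z * (1 + z * w z)"
proof -
  obtain a where a: "normalized_expansion f a" and ana: "f analytic_on unit_disk"
    and inj: "inj_on f unit_disk" and Re: "\<And>z. norm z < 1 \<Longrightarrow> Re (starlike_quotient f z) > 0"
    using assms by (auto simp: class_S_star_def class_S_def class_A_def)
  have holo: "f holomorphic_on unit_disk" using ana by (simp add: analytic_on_open)
  have f: "f has_fps_expansion Abs_fps (\<lambda>n. if n = 0 then 0 else if n = 1 then 1 else a n)"
    by (rule normalized_expansion_fps[OF a])
  have f0: "f 0 = 0"
    using has_fps_expansion_imp_0_eq_fps_nth_0[OF f] by simp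
  have df0: "deriv f 0 = 1"
    using has_fps_expansion_imp_0_eq_fps_nth_0[OF has_fps_expansion_deriv[OF f]] by simp
  obtain h where h: "h holomorphic_on unit_disk" "\<And>z. norm z < 1 \<Longrightarrow> f z = z * h z" "deriv f 0 = h 0"
    using Schwarz3[OF holo f0] by blast
  \<comment> \<open>Injectivity excludes zeros of \<open>f\<close> other than 0, and
    \<open>h 0 = deriv f 0 = 1\<close>.\<close>
  have h_nz: "h z \<noteq> 0" if z: "norm z < 1" for z
  proof
    assume "h z = 0"
    then have "f z = f 0" using h(2)[OF z] f0 by simp
    then have "z = 0" using inj z by (auto dest: inj_onD)
    then show False using \<open>h z = 0\<close> h(3) df0 by simp
  qed
  \<comment> \<open>Dividing by \<open>h\<close> instead of \<open>f\<close> builds the removable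
    singularity at 0 into the definition.\<close>
  define p where "p = (\<lambda>z. deriv f z / h z)"
  have p: "p z = starlike_quotient f z" if "norm z < 1" for z
    using h(2)[OF that] h(3) df0 by (simp add: p_def starlike_quotient_def)
  have p_holo: "p holomorphic_on unit_disk"
    unfolding p_def using h(1) h_nz holo by (intro holomorphic_intros holomorphic_deriv) auto
  have Re_p: "Re (p z) > 0" if "norm z < 1" for z using Re p that by simp
  have p1: "p z + 1 \<noteq> 0" if "norm z < 1" for z
    using Re_p[OF that] by (auto simp: complex_eq_iff)
  have less: "norm (p z - 1) < norm (p z + 1)" if "norm z < 1" for z
    using Re_p[OF that] by (simp add: cmod_def power2_eq_square algebra_simps)
  define u where "u = (\<lambda>z. (p z - 1) / (p z + 1))"
  have "u holomorphic_on unit_disk"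
    unfolding u_def using p1 p_holo by (intro holomorphic_intros) auto
  moreover have "u 0 = 0" using h(3) df0 by (simp add: u_def p_def)
  moreover have "norm (u z) < 1" if "norm z < 1" for z
    using less[OF that] p1[OF that] by (simp add: u_def norm_divide)
  ultimately obtain w where w: "w \<in> schur_class" "\<And>z. norm z < 1 \<Longrightarrow> u z = z * w z"
    using schwarz_quotient[of u] by blast
  have "z * deriv f z * (1 - z * w z) = f z * (1 + z * w z)" if z: "norm z < 1" for z
  proof -
    have "deriv f z = p z * h z" using h_nz[OF z] by (simp add: p_def)
    moreover have "p z * (1 - u z) = 1 + u z" using p1[OF z] by (simp add: u_def field_simps)
    ultimately have "z * deriv f z * (1 - u z) = z * h z * (1 + u z)" by (simp add: mult.assoc mult.left_commute)
    then show ?thesis using h(2)[OF z] w(2)[OF z] by simp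
  qed
  with w(1) that show ?thesis by blast
qed

section \<open>The extremal function\<close>

definition extremal :: "complex \<Rightarrow> complex" where
  "extremal z = z * (1 - z ^ 3) powr (- (2 / 3))"

text \<open>This keeps \<open>1 - z ^ 3\<close> off the branch cut of the principal power in
  \<open>extremal\<close>.\<close>

lemma one_minus_cube_notin_nonpos_Reals:
  fixes z :: complex
  assumes "norm z < 1"
  shows "1 - z ^ 3 \<notin> \<real>\<^sub>\<le>\<^sub>0"
proof
  assume "1 - z ^ 3 \<in> \<real>\<^sub>\<le>\<^sub>0"
  then have "1 \<le> Re (z ^ 3)" by (auto simp: complex_nonpos_Reals_iff)
  also have "\<dots> \<le> norm (z ^ 3)" by (rule complex_Re_le_cmod)
  also have "\<dots> < 1" using assms by (simp add: norm_power power_less_one_iff)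
  finally show False by simp
qed

lemma one_minus_cube_nonzero: "norm z < 1 \<Longrightarrow> 1 - z ^ 3 \<noteq> (0 :: complex)"
  using one_minus_cube_notin_nonpos_Reals[of z] by (metis nonpos_Reals_zero_I)

lemma extremal_has_derivative:
  assumes z: "norm z < 1"
  shows "(extremal has_field_derivative
    (1 + z ^ 3) / (1 - z ^ 3) * (1 - z ^ 3) powr (- (2 / 3))) (at z)"
proof -
  have nz: "1 - z ^ 3 \<noteq> 0" by (rule one_minus_cube_nonzero[OF z])
  have "(extremal has_field_derivative
      (1 - z ^ 3) powr (- (2 / 3)) + z * (- (2 / 3) * (1 - z ^ 3) powr (- (2 / 3) - 1) * (- (3 * z\<^sup>2)))) (at z)"
    unfolding extremal_def using one_minus_cube_notin_nonpos_Reals[OF z]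
    by (auto intro!: derivative_eq_intros)
  moreover have "(1 - z ^ 3) powr (- (2 / 3) - 1) = (1 - z ^ 3) powr (- (2 / 3)) / (1 - z ^ 3)"
    using nz by (simp only: powr_diff) simp
  ultimately show ?thesis
    using nz by (simp add: field_simps power2_eq_square power3_eq_cube)
qed

lemma extremal_holomorphic: "extremal holomorphic_on unit_disk"
  unfolding holomorphic_on_open[OF open_ball]
  by (intro ballI exI, rule extremal_has_derivative) simp

lemma extremal_powr_cube:
  fixes z :: complex
  assumes z: "norm z < 1"
  shows "((1 - z ^ 3) powr (- (2 / 3))) ^ 3 = 1 / (1 - z ^ 3)\<^sup>2"
proof -
  have nz: "1 - z ^ 3 \<noteq> 0" by (rule one_minus_cube_nonzero[OF z])
  have "((1 - z ^ 3) powr (- (2 / 3))) ^ 3 = exp (of_nat 3 * (- (2 / 3) * Ln (1 - z ^ 3)))"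
    using nz by (simp only: powr_def exp_of_nat_mult if_False)
  also have "\<dots> = inverse (exp (of_nat 2 * Ln (1 - z ^ 3)))"
    by (simp add: exp_minus)
  also have "\<dots> = inverse ((1 - z ^ 3)\<^sup>2)"
    unfolding exp_of_nat_mult exp_Ln[OF nz] by (rule refl)
  finally show ?thesis by (simp add: field_simps)
qed

text \<open>The cube of \<open>extremal z\<close> is the Koebe function u/(1 - u)^2 at u = z^3,
  which is injective on the disk. Once the cubes of \<open>z\<close> and \<open>w\<close> agree, so
  do the power factors, and these cancel.\<close>

lemma extremal_inj: "inj_on extremal unit_disk"
proof (rule inj_onI)
  fix z w assume "z \<in> unit_disk" "w \<in> unit_disk" and eq: "extremal z = extremal w"
  then have z: "norm z < 1" and w: "norm w < 1" by auto
  note nz = one_minus_cube_nonzero[OF z] one_minus_cube_nonzero[OF w]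
  have "z ^ 3 / (1 - z ^ 3)\<^sup>2 = w ^ 3 / (1 - w ^ 3)\<^sup>2"
    using arg_cong[OF eq, of "\<lambda>x. x ^ 3"]
    by (simp add: extremal_def power_mult_distrib extremal_powr_cube z w)
  then have "z ^ 3 * (1 - w ^ 3)\<^sup>2 = w ^ 3 * (1 - z ^ 3)\<^sup>2"
    using nz by (simp add: field_simps)
  then have "(z ^ 3 - w ^ 3) * (1 - z ^ 3 * w ^ 3) = 0" by algebra
  moreover have "norm (z ^ 3 * w ^ 3) < 1"
    using mult_strict_mono[of "norm z ^ 3" 1 "norm w ^ 3" 1] z w
    by (simp add: norm_mult norm_power power_less_one_iff)
  then have "1 - z ^ 3 * w ^ 3 \<noteq> 0" by auto
  ultimately have "z ^ 3 = w ^ 3" by simp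
  then show "z = w" using eq nz by (simp add: extremal_def)
qed

lemma extremal_starlike_quotient:
  assumes z: "norm z < 1"
  shows "starlike_quotient extremal z = (1 + z ^ 3) / (1 - z ^ 3)"
  using one_minus_cube_nonzero[OF z] DERIV_imp_deriv[OF extremal_has_derivative[OF z]]
  by (simp add: starlike_quotient_def extremal_def field_simps)

lemma Re_cayley_pos:
  fixes u :: complex
  assumes "norm u < 1"
  shows "Re ((1 + u) / (1 - u)) > 0"
proof -
  have "u \<noteq> 1" using assms by auto
  then have "(norm (1 - u))\<^sup>2 > 0" by simp
  moreover have "Re ((1 + u) * cnj (1 - u)) = 1 - (norm u)\<^sup>2"
    unfolding cmod_power2 by (simp add: power2_eq_square algebra_simps)
  moreover have "\<dots> > 0" using assms by (simp add: abs_square_less_1)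
  ultimately show ?thesis by (simp add: Re_complex_div_gt_0)
qed

lemma extremal_expansion:
  obtains a where "normalized_expansion extremal a"
proof -
  define c where "c n = (deriv ^^ n) extremal 0 / fact n" for n
  have c0: "c 0 = 0" by (simp add: c_def extremal_def)
  have c1: "c 1 = 1"
    using DERIV_imp_deriv[OF extremal_has_derivative[of 0]] by (simp add: c_def)
  have "(\<lambda>n. c (n + 2) * z ^ (n + 2)) sums (extremal z - z)" if "z \<in> unit_disk" for z
  proof -
    have "(\<lambda>n. c n * z ^ n) sums extremal z"
      using holomorphic_power_series[OF extremal_holomorphic that] by (simp add: c_def)
    then have "(\<lambda>n. c (n + 2) * z ^ (n + 2)) sums (extremal z - (\<Sum>n<2. c n * z ^ n))"
      by (rule sums_split_initial_segment)
    then show ?thesis using c0 c1 by (simp add: numeral_2_eq_2)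
  qed
  then have "normalized_expansion extremal c" unfolding normalized_expansion_def by blast
  then show ?thesis by (rule that)
qed

lemma extremal_class_S_star: "extremal \<in> class_S_star"
proof -
  have "Re (starlike_quotient extremal z) > 0" if "norm z < 1" for z
    using Re_cayley_pos[of "z ^ 3"] that
    by (simp add: extremal_starlike_quotient norm_power power_less_one_iff)
  then show ?thesis
    using extremal_expansion extremal_holomorphic extremal_inj
    by (auto simp: class_S_star_def class_S_def class_A_def analytic_on_open)
qed

text \<open>Here w = z^2, so the recursion gives a_2 = a_3 = 0 and a_4 = 2/3, and the determinant
  collapses to -a_4^2.\<close>

lemma extremal_hankel:
  assumes a: "normalized_expansion extremal a"
  shows "norm (hankel_3_1 a) = 4 / 9"
proof -
  have W: "(\<lambda>z::complex. z ^ 2) has_fps_expansion fps_X ^ 2"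
    by (intro fps_expansion_intros)
  have eq: "z * deriv extremal z * (1 - z * z ^ 2) = extremal z * (1 + z * z ^ 2)" if "norm z < 1" for z
  proof -
    have "z * z ^ 2 = z ^ 3" by (simp add: power2_eq_square power3_eq_cube)
    then show ?thesis
      using one_minus_cube_nonzero[OF that] DERIV_imp_deriv[OF extremal_has_derivative[OF that]]
      by (simp add: extremal_def)
  qed
  note coeffs = starlike_coeffs[OF a W eq]
  have a2: "a 2 = 0" using coeffs(1) by simp
  then have a3: "a 3 = 0" using coeffs(2) by simp
  have "3 * a 4 = 2" using coeffs(3) a2 a3 by simp
  then have "norm (3 * a 4) = 2" by simp
  then have "norm (a 4) = 2 / 3" by (simp add: norm_mult)
  moreover have "hankel_3_1 a = - (a 4)\<^sup>2"
    using a2 a3 by (simp add: hankel_3_1_def power2_eq_square)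
  ultimately have "norm (hankel_3_1 a) = (2 / 3)\<^sup>2"
    by (simp only: norm_minus_cancel norm_power)
  then show ?thesis by (simp add: power2_eq_square)
qed

theorem theorem2p3:
  shows "(\<forall>f a. f \<in> class_S_star \<and> normalized_expansion f a \<longrightarrow> norm (hankel_3_1 a) \<le> 4 / 9) \<and>
         (\<exists>f a. f \<in> class_S_star \<and> normalized_expansion f a \<and> norm (hankel_3_1 a) = 4 / 9)"
proof (intro conjI allI impI)
  fix f a assume "f \<in> class_S_star \<and> normalized_expansion f a"
  then show "norm (hankel_3_1 a) \<le> 4 / 9"
    using starlike_schur_function hankel_bound_schur_class by metis
next
  obtain a where "normalized_expansion extremal a" by (rule extremal_expansion)
  then show "\<exists>f a. f \<in> class_S_star \<and> normalized_expansion f a \<and> norm (hankel_3_1 a) = 4 / 9"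
    using extremal_class_S_star extremal_hankel by blast
qed

end
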